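(* Let $p,q\ge 1$ and $n\ge 2$ be integers, $N=\{1,\dots,n\}$, and let $\mathcal{A}\in\mathbb{R}^{[p,q;n,n]}$ be a real $(p,q)$th order $n\times n$ dimensional rectangular tensor. Let $S$ be a nonempty proper subset of $N$ and $\bar S=N\setminus S$. Then $$\Psi^S(\mathcal{A})\subseteq\Upsilon^S(\mathcal{A}),$$ where $\Psi^S(\mathcal{A})$ and $\Upsilon^S(\mathcal{A})$ are the subsets of $\mathbb{C}$ defined in the context.
   Context: $\mathbb{R}^{[p,q;n,n]}$ is the set of arrays $\mathcal{A}=(a_{i_1\cdots i_pj_1\cdots j_q})$ of real numbers with all indices in $N=\{1,\dots,n\}$. Row/column sums: $R_i(\mathcal{A})=\sum_{i_2,\dots,i_p,j_1,\dots,j_q\in N}|a_{ii_2\cdots i_pj_1\cdots j_q}|$ and $C_j(\mathcal{A})=\sum_{i_1,\dots,i_p,j_2,\dots,j_q\in N}|a_{i_1\cdots i_pjj_2\cdots j_q}|$. Write $a_{ij\cdots jj\cdots j}$ for the entry with $i_1=i$ and all other indices ($i_2,\dots,i_p,j_1,\dots,j_q$) equal to $j$, and $a_{j\cdots jij\cdots j}$ for the entry with $j_1=i$ and all other indices ($i_1,\dots,i_p,j_2,\dots,j_q$) equal to $j$. Put $r_i^j(\mathcal{A})=R_i(\mathcal{A})-|a_{ij\cdots jj\cdots j}|$ and $c_i^j(\mathcal{A})=C_i(\mathcal{A})-|a_{j\cdots jij\cdots j}|$. The set $\Upsilon^S(\mathcal{A})$ is $$\Upsilon^S(\mathcal{A})=\left(\bigcup_{i\in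 S,\,j\in\bar S}\left(\hat\Upsilon_{i,j}(\mathcal{A})\cup\tilde\Upsilon_{i,j}(\mathcal{A})\right)\right)\cup\left(\bigcup_{i\in\bar S,\,j\in S}\left(\hat\Upsilon_{i,j}(\mathcal{A})\cup\tilde\Upsilon_{i,j}(\mathcal{A})\right)\right),$$ $$\hat\Upsilon_{i,j}(\mathcal{A})=\{z\in\mathbb{C}:(|z|-r_i^j(\mathcal{A}))|z|\le|a_{ij\cdots jj\cdots j}|\max\{R_j(\mathcal{A}),C_j(\mathcal{A})\}\},$$ $$\tilde\Upsilon_{i,j}(\mathcal{A})=\{z\in\mathbb{C}:(|z|-c_i^j(\mathcal{A}))|z|\le|a_{j\cdots jij\cdots j}|\max\{R_j(\mathcal{A}),C_j(\mathcal{A})\}\}.$$ For $T\subseteq N$ let $\Delta^T=\{(i_2,\dots,i_p,j_1,\dots,j_q): \text{all entries in }T\}$, $\Omega^T=\{(i_1,\dots,i_p,j_2,\dots,j_q):\text{all entries in }T\}$, $\overline{\Delta^T}=\Delta^N\setminus\Delta^T$, $\overline{\Omega^T}=\Omega^N\setminus\Omega^T$. For $i,j\in N$, with $\Delta'\in\{\Delta^T,\overline{\Delta^T}\}$ and $\Omega'\in\{\Omega^T,\overline{\Omega^T}\}$, $$r_i^{\Delta'}(\mathcal{A})=\sum_{(i_2,\dots,i_p,j_1,\dots,j_q)\in\Delta'}|a_{ii_2\cdots i_pj_1\cdots j_q}|,\qquad c_j^{\Omega'}(\mathcal{A})=\sum_{(i_1,\dots,i_p,j_2,\dots,j_q)\in\Omega'}|a_{i_1\cdots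 i_pjj_2\cdots j_q}|.$$ The set $\Psi^S(\mathcal{A})$ is $$\Psi^S(\mathcal{A})=\left(\bigcup_{i\in S,\,j\in\bar S}\left(\hat\Psi^{S}_{i,j}(\mathcal{A})\cup\tilde\Psi^{S}_{i,j}(\mathcal{A})\right)\right)\cup\left(\bigcup_{i\in\bar S,\,j\in S}\left(\hat\Psi^{\bar S}_{i,j}(\mathcal{A})\cup\tilde\Psi^{\bar S}_{i,j}(\mathcal{A})\right)\right),$$ where, for $T\in\{S,\bar S\}$, $$\hat\Psi^{T}_{i,j}(\mathcal{A})=\left\{z\in\mathbb{C}:\left(|z|-r_j^{\overline{\Delta^T}}(\mathcal{A})\right)|z|\le r_j^{\Delta^T}(\mathcal{A})\max\{R_i(\mathcal{A}),C_i(\mathcal{A})\}\right\},$$ $$\tilde\Psi^{T}_{i,j}(\mathcal{A})=\left\{z\in\mathbb{C}:\left(|z|-c_j^{\overline{\Omega^T}}(\mathcal{A})\right)|z|\le c_j^{\Omega^T}(\mathcal{A})\max\{R_i(\mathcal{A}),C_i(\mathcal{A})\}\right\}.$$ *)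

theory Defs
  imports Complex_Main "HOL-Library.FuncSet"
begin

definition index_lists :: "nat \<Rightarrow> nat set \<Rightarrow> nat list set" where
  "index_lists k T = {xs. set xs \<subseteq> T \<and> length xs = k}"

text \<open>
  The entry with indices \<open>i\<^sub>1 \<dots> i\<^sub>p j\<^sub>1 \<dots> j\<^sub>q\<close> of a tensor \<open>A\<close> is
  \<open>A ([i\<^sub>1, \<dots>, i\<^sub>p], [j\<^sub>1, \<dots>, j\<^sub>q])\<close>.
\<close>

type_synonym rect_tensor = "nat list \<times> nat list \<Rightarrow> real"

definition rect_tensors :: "nat \<Rightarrow> nat \<Rightarrow> nat \<Rightarrow> rect_tensor set" where
  "rect_tensors p q n = (index_lists p {1..n} \<times> index_lists q {1..n}) \<rightarrow>\<^sub>E UNIV"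

text \<open>
  \<open>\<Delta>\<^sup>T\<close> consists of \<open>(i\<^sub>2, \<dots>, i\<^sub>p, j\<^sub>1, \<dots>, j\<^sub>q)\<close> and
  \<open>\<Omega>\<^sup>T\<close> of \<open>(i\<^sub>1, \<dots>, i\<^sub>p, j\<^sub>2, \<dots>, j\<^sub>q)\<close>, all entries in \<open>T\<close>;
  \<open>p, q \<ge> 1\<close> is intended.
\<close>

definition Delta :: "nat \<Rightarrow> nat \<Rightarrow> nat set \<Rightarrow> (nat list \<times> nat list) set" where
  "Delta p q T = index_lists (p - 1) T \<times> index_lists q T"

definition Omega :: "nat \<Rightarrow> nat \<Rightarrow> nat set \<Rightarrow> (nat list \<times> nat list) set" where
  "Omega p q T = index_lists p T \<times> index_lists (q - 1) T"

definition Delta_bar :: "nat \<Rightarrow> nat \<Rightarrow> nat \<Rightarrow> nat set \<Rightarrow> (nat list \<times> nat list) set" where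
  "Delta_bar p q n T = Delta p q {1..n} - Delta p q T"

definition Omega_bar :: "nat \<Rightarrow> nat \<Rightarrow> nat \<Rightarrow> nat set \<Rightarrow> (nat list \<times> nat list) set" where
  "Omega_bar p q n T = Omega p q {1..n} - Omega p q T"

definition row_part :: "rect_tensor \<Rightarrow> (nat list \<times> nat list) set \<Rightarrow> nat \<Rightarrow> real" where
  "row_part A D i = (\<Sum>(is, js)\<in>D. \<bar>A (i # is, js)\<bar>)"

definition col_part :: "rect_tensor \<Rightarrow> (nat list \<times> nat list) set \<Rightarrow> nat \<Rightarrow> real" where
  "col_part A D j = (\<Sum>(is, js)\<in>D. \<bar>A (is, j # js)\<bar>)"

definition row_sum :: "nat \<Rightarrow> nat \<Rightarrow> nat \<Rightarrow> rect_tensor \<Rightarrow> nat \<Rightarrow> real" where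
  "row_sum p q n A i = row_part A (Delta p q {1..n}) i"

definition col_sum :: "nat \<Rightarrow> nat \<Rightarrow> nat \<Rightarrow> rect_tensor \<Rightarrow> nat \<Rightarrow> real" where
  "col_sum p q n A j = col_part A (Omega p q {1..n}) j"

text \<open>The entries \<open>a\<^bsub>ij\<dots>jj\<dots>j\<^esub>\<close> and \<open>a\<^bsub>j\<dots>jij\<dots>j\<^esub>\<close>.\<close>

definition row_entry :: "nat \<Rightarrow> nat \<Rightarrow> rect_tensor \<Rightarrow> nat \<Rightarrow> nat \<Rightarrow> real" where
  "row_entry p q A i j = A (i # replicate (p - 1) j, replicate q j)"

definition col_entry :: "nat \<Rightarrow> nat \<Rightarrow> rect_tensor \<Rightarrow> nat \<Rightarrow> nat \<Rightarrow> real" where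
  "col_entry p q A i j = A (replicate p j, i # replicate (q - 1) j)"

text \<open>\<open>r\<^sub>i\<^sup>j\<close> and \<open>c\<^sub>i\<^sup>j\<close>:\<close>

definition row_rest :: "nat \<Rightarrow> nat \<Rightarrow> nat \<Rightarrow> rect_tensor \<Rightarrow> nat \<Rightarrow> nat \<Rightarrow> real" where
  "row_rest p q n A i j = row_sum p q n A i - \<bar>row_entry p q A i j\<bar>"

definition col_rest :: "nat \<Rightarrow> nat \<Rightarrow> nat \<Rightarrow> rect_tensor \<Rightarrow> nat \<Rightarrow> nat \<Rightarrow> real" where
  "col_rest p q n A i j = col_sum p q n A i - \<bar>col_entry p q A i j\<bar>"

definition Upsilon_hat :: "nat \<Rightarrow> nat \<Rightarrow> nat \<Rightarrow> rect_tensor \<Rightarrow> nat \<Rightarrow> nat \<Rightarrow> complex set" where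
  "Upsilon_hat p q n A i j =
    {z. (cmod z - row_rest p q n A i j) * cmod z
        \<le> \<bar>row_entry p q A i j\<bar> * max (row_sum p q n A j) (col_sum p q n A j)}"

definition Upsilon_tilde :: "nat \<Rightarrow> nat \<Rightarrow> nat \<Rightarrow> rect_tensor \<Rightarrow> nat \<Rightarrow> nat \<Rightarrow> complex set" where
  "Upsilon_tilde p q n A i j =
    {z. (cmod z - col_rest p q n A i j) * cmod z
        \<le> \<bar>col_entry p q A i j\<bar> * max (row_sum p q n A j) (col_sum p q n A j)}"

definition Upsilon :: "nat \<Rightarrow> nat \<Rightarrow> nat \<Rightarrow> nat set \<Rightarrow> rect_tensor \<Rightarrow> complex set" where
  "Upsilon p q n S A =
    (\<Union>i\<in>S. \<Union>j\<in>{1..n} - S. Upsilon_hat p q n A i j \<union> Upsilon_tilde p q n A i j) \<union>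
    (\<Union>i\<in>{1..n} - S. \<Union>j\<in>S. Upsilon_hat p q n A i j \<union> Upsilon_tilde p q n A i j)"

definition Psi_hat ::
  "nat \<Rightarrow> nat \<Rightarrow> nat \<Rightarrow> nat set \<Rightarrow> rect_tensor \<Rightarrow> nat \<Rightarrow> nat \<Rightarrow> complex set" where
  "Psi_hat p q n T A i j =
    {z. (cmod z - row_part A (Delta_bar p q n T) j) * cmod z
        \<le> row_part A (Delta p q T) j * max (row_sum p q n A i) (col_sum p q n A i)}"

definition Psi_tilde ::
  "nat \<Rightarrow> nat \<Rightarrow> nat \<Rightarrow> nat set \<Rightarrow> rect_tensor \<Rightarrow> nat \<Rightarrow> nat \<Rightarrow> complex set" where
  "Psi_tilde p q n T A i j =
    {z. (cmod z - col_part A (Omega_bar p q n T) j) * cmod z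
        \<le> col_part A (Omega p q T) j * max (row_sum p q n A i) (col_sum p q n A i)}"

definition Psi :: "nat \<Rightarrow> nat \<Rightarrow> nat \<Rightarrow> nat set \<Rightarrow> rect_tensor \<Rightarrow> complex set" where
  "Psi p q n S A =
    (\<Union>i\<in>S. \<Union>j\<in>{1..n} - S. Psi_hat p q n S A i j \<union> Psi_tilde p q n S A i j) \<union>
    (\<Union>i\<in>{1..n} - S. \<Union>j\<in>S.
      Psi_hat p q n ({1..n} - S) A i j \<union> Psi_tilde p q n ({1..n} - S) A i j)"

end

theory Submission imports Defs begin

text \<open>
  Fix \<open>i \<in> T\<close> and \<open>j \<in> N\<close>, where \<open>T\<close> is \<open>S\<close> or its complement, put \<open>t = \<bar>z\<bar>\<close> and
  \<open>P\<^sub>k = max R\<^sub>k C\<^sub>k\<close>. The inclusion already holds pair by pair, up to exchanging \<open>i\<close> and \<open>j\<close>: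
  a point of \<open>\<Psi>\<^bsub>i,j\<^esub>\<close> lies in \<open>\<Upsilon>\<^bsub>j,i\<^esub>\<close> or in \<open>\<Upsilon>\<^bsub>i,j\<^esub>\<close>, hats and tildes taken together. The union
  defining \<open>\<Upsilon>\<^sup>S\<close> contains both orders of each pair.

  With \<open>r = r\<^sub>j\<^sup>\<Delta>\<close> and \<open>a\<close>, \<open>a'\<close> the absolute values of \<open>a\<^bsub>ji\<dots>i\<^esub>\<close> and \<open>a\<^bsub>ij\<dots>j\<^esub>\<close>, the hatted conditions read
  \<^item> \<open>t\<^sup>2 - R\<^sub>j t \<le> r (P\<^sub>i - t)\<close> for \<open>\<Psi>\<^bsub>i,j\<^esub>\<close>,
  \<^item> \<open>t\<^sup>2 - R\<^sub>j t \<le> a (P\<^sub>i - t)\<close> for \<open>\<Upsilon>\<^bsub>j,i\<^esub>\<close>,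
  \<^item> \<open>t\<^sup>2 - R\<^sub>i t \<le> a' (P\<^sub>j - t)\<close> for \<open>\<Upsilon>\<^bsub>i,j\<^esub>\<close>.

  If \<open>t \<ge> P\<^sub>i\<close>, the first implies the second, because \<open>a\<close> is one of the terms of \<open>r\<close>. If
  \<open>t < P\<^sub>i\<close>, say \<open>P\<^sub>i = R\<^sub>i\<close>, the third is immediate for \<open>t \<le> P\<^sub>j\<close>. For \<open>t > P\<^sub>j\<close>, the
  failure of the third bounds \<open>R\<^sub>i - t\<close> from above; inserting this bound into the first and dividing
  by \<open>t - R\<^sub>j > 0\<close> gives \<open>t\<^sup>2 \<le> r a'\<close>. But
  \<open>r \<le> R\<^sub>j \<le> P\<^sub>j < t\<close>, and the entry \<open>a\<^bsub>ij\<dots>j\<^esub>\<close> has first column index \<open>j\<close>, hence is counted in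
  \<open>C\<^sub>j\<close> and \<open>a' \<le> P\<^sub>j < t\<close> as well. When \<open>P\<^sub>i = C\<^sub>i\<close>, the same argument runs with the tilde set
  \<open>\<Upsilon>\<^bsub>i,j\<^esub>\<close>, whose entry \<open>a\<^bsub>j\<dots>jij\<dots>j\<^esub>\<close> is counted in \<open>R\<^sub>j\<close>. The estimates on \<open>t\<close> use only these
  comparisons, so they are isolated as statements about real numbers and serve rows and columns
  alike.
\<close>

text \<open>
  Here \<open>X\<close> is whichever of \<open>R\<^sub>i\<close>, \<open>C\<^sub>i\<close> attains \<open>P\<^sub>i\<close>, while \<open>r\<close> and \<open>s\<close> are the two parts into which
  \<open>R\<^sub>j\<close> (or \<open>C\<^sub>j\<close>) is split by \<open>T\<close>. For \<open>t > P\<close> the given inequality and the negated conclusion bound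
  \<open>X - t\<close> from below and from above; eliminating it leaves
  \<open>t\<^sup>2 \<le> r b\<close>, which \<open>r, b \<le> P < t\<close> excludes.
\<close>

lemma bound_transfer_below:
  fixes t r s b X P :: real
  assumes "0 \<le> t" "0 \<le> r" "r + s \<le> P" "0 \<le> s" "0 \<le> b" "b \<le> P" "t \<le> X"
    and psi: "(t - s) * t \<le> r * X"
  shows "(t - (X - b)) * t \<le> b * P"
proof (cases "t \<le> P")
  case True
  have "(t - X) * t \<le> 0"
    using assms by (simp add: mult_nonpos_nonneg)
  moreover have "b * t \<le> b * P"
    using True assms by (simp add: mult_left_mono)
  ultimately show ?thesis
    by (simp add: algebra_simps)
next
  case False
  show ?thesis
  proof (rule ccontr)
    assume "\<not> ?thesis"
    then have neg: "t * (X - t) \<le> b * (t - P)"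
      by (simp add: algebra_simps)
    have psi': "t * (t - (r + s)) \<le> r * (X - t)"
      using psi by (simp add: algebra_simps)
    have "t * (t * (t - (r + s))) \<le> r * (t * (X - t))"
      using mult_left_mono[OF psi' \<open>0 \<le> t\<close>] by (simp add: algebra_simps)
    also have "\<dots> \<le> r * (b * (t - P))"
      using neg assms by (simp add: mult_left_mono)
    also have "\<dots> \<le> r * (b * (t - (r + s)))"
      using assms by (intro mult_left_mono) auto
    finally have "(t * t) * (t - (r + s)) \<le> (r * b) * (t - (r + s))"
      by (simp add: algebra_simps)
    moreover have "t - (r + s) > 0"
      using False assms by simp
    ultimately have "t * t \<le> r * b"
      by (meson mult_le_cancel_right_pos)
    moreover have "r * b < t * t"
      using False assms by (intro mult_strict_mono') auto
    ultimately show False by simp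
  qed
qed

text \<open>
  The row and the column versions of \<open>\<Psi>\<close> both reduce to this trichotomy: \<open>a\<close> is the entry common
  to \<open>r\<close> and \<open>\<Upsilon>\<^bsub>j,i\<^esub>\<close>, and \<open>b\<close>, \<open>c\<close> are the entries of the hat and the tilde set \<open>\<Upsilon>\<^bsub>i,j\<^esub>\<close>.
\<close>

lemma bound_transfer:
  fixes t a b c r s R C P :: real
  assumes "0 \<le> t" "0 \<le> a" "a \<le> r" "0 \<le> s" "r + s \<le> P"
    and "0 \<le> b" "b \<le> P" "0 \<le> c" "c \<le> P"
    and psi: "(t - s) * t \<le> r * max R C"
  shows "(t - (r + s - a)) * t \<le> a * max R C \<or>
    (t - (R - b)) * t \<le> b * P \<or> (t - (C - c)) * t \<le> c * P"
proof (cases "max R C \<le> t")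
  case True
  have "(r - a) * max R C \<le> (r - a) * t"
    using True assms by (intro mult_left_mono) auto
  with psi show ?thesis
    by (simp add: algebra_simps)
next
  case False
  show ?thesis
  proof (cases "C \<le> R")
    case True
    then show ?thesis
      using bound_transfer_below[of t r s P b R] False assms by (simp add: max_def)
  next
    case C: False
    then show ?thesis
      using bound_transfer_below[of t r s P c C] False assms by (simp add: max_def)
  qed
qed

lemma finite_index_lists: "finite T \<Longrightarrow> finite (index_lists k T)"
  unfolding index_lists_def by (rule finite_lists_length_eq)

lemma replicate_in_index_lists: "x \<in> T \<Longrightarrow> replicate k x \<in> index_lists k T"
  by (auto simp: index_lists_def)

lemma index_lists_mono: "T \<subseteq> U \<Longrightarrow> index_lists k T \<subseteq> index_lists k U"
  by (auto simp: index_lists_def)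

lemma finite_Delta: "finite T \<Longrightarrow> finite (Delta p q T)"
  by (simp add: Delta_def finite_index_lists)

lemma finite_Omega: "finite T \<Longrightarrow> finite (Omega p q T)"
  by (simp add: Omega_def finite_index_lists)

lemma row_part_nonneg: "0 \<le> row_part A D i"
  unfolding row_part_def by (rule sum_nonneg) auto

lemma col_part_nonneg: "0 \<le> col_part A D j"
  unfolding col_part_def by (rule sum_nonneg) auto

lemma entry_le_row_part:
  assumes "finite D" "(is, js) \<in> D"
  shows "\<bar>A (i # is, js)\<bar> \<le> row_part A D i"
  using member_le_sum[of "(is, js)" D "\<lambda>(is, js). \<bar>A (i # is, js)\<bar>"] assms
  by (auto simp: row_part_def)

lemma entry_le_col_part:
  assumes "finite D" "(is, js) \<in> D"
  shows "\<bar>A (is, j # js)\<bar> \<le> col_part A D j"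
  using member_le_sum[of "(is, js)" D "\<lambda>(is, js). \<bar>A (is, j # js)\<bar>"] assms
  by (auto simp: col_part_def)

lemma row_entry_le_row_part:
  assumes "finite T" "i \<in> T"
  shows "\<bar>row_entry p q A j i\<bar> \<le> row_part A (Delta p q T) j"
  unfolding row_entry_def using assms
  by (intro entry_le_row_part finite_Delta) (auto simp: Delta_def replicate_in_index_lists)

lemma col_entry_le_col_part:
  assumes "finite T" "i \<in> T"
  shows "\<bar>col_entry p q A j i\<bar> \<le> col_part A (Omega p q T) j"
  unfolding col_entry_def using assms
  by (intro entry_le_col_part finite_Omega) (auto simp: Omega_def replicate_in_index_lists)

text \<open>
  For \<open>q \<ge> 1\<close> the entry \<open>a\<^bsub>ij\<dots>jj\<dots>j\<^esub>\<close> has at least one column index, and the first one is \<open>j\<close>; so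
  an entry of row \<open>i\<close> is controlled by a quantity that belongs to \<open>j\<close>.
\<close>

lemma row_entry_le_col_sum:
  assumes "p \<ge> 1" "q \<ge> 1" "i \<in> {1..n}" "j \<in> {1..n}"
  shows "\<bar>row_entry p q A i j\<bar> \<le> col_sum p q n A j"
proof -
  have "replicate q j = j # replicate (q - 1) j"
    using \<open>q \<ge> 1\<close> by (cases q) auto
  moreover have "(i # replicate (p - 1) j, replicate (q - 1) j) \<in> Omega p q {1..n}"
    using assms by (auto simp: Omega_def index_lists_def)
  ultimately show ?thesis
    unfolding row_entry_def col_sum_def by (simp add: entry_le_col_part finite_Omega)
qed

lemma col_entry_le_row_sum:
  assumes "p \<ge> 1" "q \<ge> 1" "i \<in> {1..n}" "j \<in> {1..n}"
  shows "\<bar>col_entry p q A i j\<bar> \<le> row_sum p q n A j"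
proof -
  have "replicate p j = j # replicate (p - 1) j"
    using \<open>p \<ge> 1\<close> by (cases p) auto
  moreover have "(replicate (p - 1) j, i # replicate (q - 1) j) \<in> Delta p q {1..n}"
    using assms by (auto simp: Delta_def index_lists_def)
  ultimately show ?thesis
    unfolding col_entry_def row_sum_def by (simp add: entry_le_row_part finite_Delta)
qed

lemma row_sum_split:
  assumes "T \<subseteq> {1..n}"
  shows "row_sum p q n A j = row_part A (Delta p q T) j + row_part A (Delta_bar p q n T) j"
proof -
  have "Delta p q T \<subseteq> Delta p q {1..n}"
    unfolding Delta_def by (intro Sigma_mono index_lists_mono assms)
  then show ?thesis
    unfolding row_sum_def row_part_def Delta_bar_def
    by (subst sum.subset_diff[of "Delta p q T"]) (auto simp: finite_Delta add.commute)
qed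

lemma col_sum_split:
  assumes "T \<subseteq> {1..n}"
  shows "col_sum p q n A j = col_part A (Omega p q T) j + col_part A (Omega_bar p q n T) j"
proof -
  have "Omega p q T \<subseteq> Omega p q {1..n}"
    unfolding Omega_def by (intro Sigma_mono index_lists_mono assms)
  then show ?thesis
    unfolding col_sum_def col_part_def Omega_bar_def
    by (subst sum.subset_diff[of "Omega p q T"]) (auto simp: finite_Omega add.commute)
qed

lemma Psi_hat_subset:
  assumes "p \<ge> 1" "q \<ge> 1" "T \<subseteq> {1..n}" "i \<in> T" "j \<in> {1..n}"
  shows "Psi_hat p q n T A i j \<subseteq>
    Upsilon_hat p q n A j i \<union> (Upsilon_hat p q n A i j \<union> Upsilon_tilde p q n A i j)"
proof
  fix z assume z: "z \<in> Psi_hat p q n T A i j"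
  have T: "finite T" and i: "i \<in> {1..n}"
    using assms finite_subset by auto
  note split = row_sum_split[OF \<open>T \<subseteq> {1..n}\<close>, of p q A j]
  show "z \<in> Upsilon_hat p q n A j i \<union> (Upsilon_hat p q n A i j \<union> Upsilon_tilde p q n A i j)"
    using bound_transfer[of "cmod z" "\<bar>row_entry p q A j i\<bar>" "row_part A (Delta p q T) j"
        "row_part A (Delta_bar p q n T) j" "max (row_sum p q n A j) (col_sum p q n A j)"
        "\<bar>row_entry p q A i j\<bar>" "\<bar>col_entry p q A i j\<bar>" "row_sum p q n A i" "col_sum p q n A i"]
      z row_entry_le_row_part[OF T \<open>i \<in> T\<close>, of p q A j] row_part_nonneg[of A _ j]
      row_entry_le_col_sum[OF assms(1,2) i \<open>j \<in> {1..n}\<close>, of A]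
      col_entry_le_row_sum[OF assms(1,2) i \<open>j \<in> {1..n}\<close>, of A]
    by (simp add: Psi_hat_def Upsilon_hat_def Upsilon_tilde_def row_rest_def col_rest_def
        split le_max_iff_disj)
qed

lemma Psi_tilde_subset:
  assumes "p \<ge> 1" "q \<ge> 1" "T \<subseteq> {1..n}" "i \<in> T" "j \<in> {1..n}"
  shows "Psi_tilde p q n T A i j \<subseteq>
    Upsilon_tilde p q n A j i \<union> (Upsilon_hat p q n A i j \<union> Upsilon_tilde p q n A i j)"
proof
  fix z assume z: "z \<in> Psi_tilde p q n T A i j"
  have T: "finite T" and i: "i \<in> {1..n}"
    using assms finite_subset by auto
  note split = col_sum_split[OF \<open>T \<subseteq> {1..n}\<close>, of p q A j]
  show "z \<in> Upsilon_tilde p q n A j i \<union> (Upsilon_hat p q n A i j \<union> Upsilon_tilde p q n A i j)"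
    using bound_transfer[of "cmod z" "\<bar>col_entry p q A j i\<bar>" "col_part A (Omega p q T) j"
        "col_part A (Omega_bar p q n T) j" "max (row_sum p q n A j) (col_sum p q n A j)"
        "\<bar>row_entry p q A i j\<bar>" "\<bar>col_entry p q A i j\<bar>" "row_sum p q n A i" "col_sum p q n A i"]
      z col_entry_le_col_part[OF T \<open>i \<in> T\<close>, of p q A j] col_part_nonneg[of A _ j]
      row_entry_le_col_sum[OF assms(1,2) i \<open>j \<in> {1..n}\<close>, of A]
      col_entry_le_row_sum[OF assms(1,2) i \<open>j \<in> {1..n}\<close>, of A]
    by (simp add: Psi_tilde_def Upsilon_hat_def Upsilon_tilde_def row_rest_def col_rest_def
        split le_max_iff_disj)
qed

theorem theorem4:
  fixes p q n :: nat and S :: "nat set" and A :: rect_tensor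
  assumes "p \<ge> 1" and "q \<ge> 1" and "n \<ge> 2"
    and "A \<in> rect_tensors p q n"
    and "S \<noteq> {}" and "S \<subset> {1..n}"
  shows "Psi p q n S A \<subseteq> Upsilon p q n S A"
proof -
  have pair: "Psi_hat p q n T A i j \<union> Psi_tilde p q n T A i j \<subseteq>
      (Upsilon_hat p q n A i j \<union> Upsilon_tilde p q n A i j) \<union>
      (Upsilon_hat p q n A j i \<union> Upsilon_tilde p q n A j i)"
    if "T \<subseteq> {1..n}" "i \<in> T" "j \<in> {1..n}" for T i j
    using Psi_hat_subset[OF assms(1,2) that, of A] Psi_tilde_subset[OF assms(1,2) that, of A]
    by blast
  have "Psi_hat p q n S A i j \<union> Psi_tilde p q n S A i j \<subseteq> Upsilon p q n S A"
    if "i \<in> S" "j \<in> {1..n} - S" for i j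
  proof -
    have "(Upsilon_hat p q n A i j \<union> Upsilon_tilde p q n A i j) \<union>
        (Upsilon_hat p q n A j i \<union> Upsilon_tilde p q n A j i) \<subseteq> Upsilon p q n S A"
      unfolding Upsilon_def using that by blast
    then show ?thesis
      using pair[of S i j] that assms by blast
  qed
  moreover have "Psi_hat p q n ({1..n} - S) A i j \<union> Psi_tilde p q n ({1..n} - S) A i j
      \<subseteq> Upsilon p q n S A"
    if "i \<in> {1..n} - S" "j \<in> S" for i j
  proof -
    have "(Upsilon_hat p q n A i j \<union> Upsilon_tilde p q n A i j) \<union>
        (Upsilon_hat p q n A j i \<union> Upsilon_tilde p q n A j i) \<subseteq> Upsilon p q n S A"
      unfolding Upsilon_def using that by blast
    then show ?thesis
      using pair[of "{1..n} - S" i j] that assms by blast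
  qed
  ultimately show ?thesis
    unfolding Psi_def by blast
qed

end
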